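(* The digraph $\vec{C}_3\Rightarrow K_1$ is not a hero in orientations of chordal graphs; that is, for every integer $k$ there exists an orientation of a chordal graph containing no induced copy of $\vec{C}_3\Rightarrow K_1$ and having dichromatic number greater than $k$.
   Context: All digraphs are finite and simple (no loops, no parallel arcs, no digons). An orientation of a chordal graph is a digraph whose underlying undirected graph has no induced cycle of length at least $4$. The dichromatic number of a digraph is the least $k$ such that its vertex set can be partitioned into $k$ sets each inducing an acyclic subdigraph. A digraph $H$ is a hero in a hereditary class $\mathcal{C}$ if the digraphs in $\mathcal{C}$ with no induced copy of $H$ have bounded dichromatic number. $\vec{C}_3\Rightarrow K_1$ is the digraph consisting of a directed triangle together with a fourth vertex that is an out-neighbour of all three triangle vertices. *)

theory Defs
  imports "Graph_Theory.Graph_Theory" "HOL-Library.Disjoint_Sets"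
begin

definition oriented :: "'a pair_pre_digraph \<Rightarrow> bool" where
  "oriented G \<longleftrightarrow> pair_digraph G \<and> (\<forall>u v. (u, v) \<in> parcs G \<longrightarrow> (v, u) \<notin> parcs G)"

definition contains_induced ::
    "('a, 'b) pre_digraph \<Rightarrow> ('c, 'd) pre_digraph \<Rightarrow> bool" where
  "contains_induced G H \<longleftrightarrow> (\<exists>G'. induced_subgraph G' G \<and> digraph_iso G' H)"

text \<open>Undirected graphs are symmetric digraphs, as in \<^const>\<open>mk_symmetric\<close>. Below,
  \<^term>\<open>cycle_graph n\<close> is used only for \<^term>\<open>n \<ge> 4\<close>; for \<^term>\<open>n < 3\<close> it is not a cycle.\<close>

definition cycle_graph :: "nat \<Rightarrow> nat pair_pre_digraph" where
  "cycle_graph n = \<lparr> pverts = {..<n},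
     parcs = {(i, j). i < n \<and> j < n \<and> (j = Suc i mod n \<or> i = Suc j mod n)} \<rparr>"

definition chordal :: "'a pair_pre_digraph \<Rightarrow> bool" where
  "chordal U \<longleftrightarrow> \<not> (\<exists>n\<ge>4. contains_induced (with_proj U) (with_proj (cycle_graph n)))"

definition chordal_orientations :: "'a pair_pre_digraph set" where
  "chordal_orientations = {G. oriented G \<and> chordal (mk_symmetric (with_proj G))}"

definition acyclic_digraph :: "('a, 'b) pre_digraph \<Rightarrow> bool" where
  "acyclic_digraph G \<longleftrightarrow> \<not> (\<exists>p. pre_digraph.cycle G p)"

text \<open>The blocks of \<^const>\<open>partition_on\<close> are nonempty; since only the least number of blocks
  matters, allowing empty parts would give the same value.\<close>

definition dichromatic_number :: "'a pair_pre_digraph \<Rightarrow> nat" where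
  "dichromatic_number G = (LEAST k. \<exists>P. partition_on (pverts G) P \<and> finite P \<and> card P = k \<and>
     (\<forall>X\<in>P. acyclic_digraph (with_proj G \<restriction> X)))"

text \<open>A class of finite digraphs is represented by its members with vertices in a fixed infinite
  type, e.g. \<^typ>\<open>nat\<close>, which meets every isomorphism type.\<close>

definition hero_in :: "'a pair_pre_digraph \<Rightarrow> 'b pair_pre_digraph set \<Rightarrow> bool" where
  "hero_in H \<C> \<longleftrightarrow> (\<exists>k. \<forall>G\<in>\<C>. \<not> contains_induced (with_proj G) (with_proj H) \<longrightarrow>
     dichromatic_number G \<le> k)"

definition C3_to_K1 :: "nat pair_pre_digraph" where
  "C3_to_K1 = \<lparr> pverts = {0, 1, 2, 3},
     parcs = {(0, 1), (1, 2), (2, 0), (0, 3), (1, 3), (2, 3)} \<rparr>"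

end

(* Let S and T be transitive tournaments on j vertices with S complete to T, and let v satisfy
   T => v => S.  Suppose that a colouring has no monochromatic directed triangle and that both S
   and T are rainbow.  If T uses a colour t missing in S, then S together with the vertex of that
   colour is a rainbow transitive tournament on j + 1 vertices; otherwise S and T use the same
   colours, v cannot repeat any of them, and T together with v is one.  So repeatedly attaching
   new vertices to existing cliques forces arbitrarily large rainbow transitive tournaments.
   The graph stays chordal because each new vertex is simplicial, and no in-neighbourhood ever
   contains a directed triangle. *)

theory Submission
  imports Defs
begin

section \<open>Invariants of the construction\<close>

definition adj :: "'a pair_pre_digraph \<Rightarrow> 'a \<Rightarrow> 'a \<Rightarrow> bool" where
  "adj G x y \<longleftrightarrow> (x, y) \<in> parcs G \<or> (y, x) \<in> parcs G"

definition simplicial_in :: "'a pair_pre_digraph \<Rightarrow> 'a set \<Rightarrow> 'a \<Rightarrow> bool" where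
  "simplicial_in G W v \<longleftrightarrow>
     (\<forall>x\<in>W. \<forall>y\<in>W. adj G v x \<longrightarrow> adj G v y \<longrightarrow> x \<noteq> y \<longrightarrow> adj G x y)"

text \<open>The six arcs join every pair of the four vertices, so in an orientation any such pattern
  is automatically injective and induced. Speaking of arcs alone avoids isomorphisms during the
  construction.\<close>

definition in_triangle_free :: "'a pair_pre_digraph \<Rightarrow> bool" where
  "in_triangle_free G \<longleftrightarrow> \<not> (\<exists>a b c d. {(a, b), (b, c), (c, a), (a, d), (b, d), (c, d)} \<subseteq> parcs G)"

text \<open>The last clause is a hereditary form of a perfect elimination ordering, the usual
  certificate of chordality. It survives the addition of a simplicial vertex and can be applied
  directly to the vertex set of a long cycle.\<close>

definition good :: "'a pair_pre_digraph \<Rightarrow> bool" where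
  "good G \<longleftrightarrow> oriented G \<and> in_triangle_free G \<and>
     (\<forall>W\<subseteq>pverts G. W \<noteq> {} \<longrightarrow> (\<exists>v\<in>W. simplicial_in G W v))"

definition extends :: "'a pair_pre_digraph \<Rightarrow> 'a pair_pre_digraph \<Rightarrow> bool" where
  "extends G H \<longleftrightarrow> pverts G \<subseteq> pverts H \<and> parcs G \<subseteq> parcs H"

definition trans_tour :: "'a pair_pre_digraph \<Rightarrow> 'a list \<Rightarrow> bool" where
  "trans_tour G xs \<longleftrightarrow> set xs \<subseteq> pverts G \<and> sorted_wrt (\<lambda>x y. (x, y) \<in> parcs G) xs"

text \<open>This is what the argument retains of a partition into acyclic parts, with
  \<open>f\<close> naming the part of a vertex.\<close>

definition no_mono_triangle :: "'a pair_pre_digraph \<Rightarrow> ('a \<Rightarrow> 'c) \<Rightarrow> bool" where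
  "no_mono_triangle G f \<longleftrightarrow>
     \<not> (\<exists>a b c. {(a, b), (b, c), (c, a)} \<subseteq> parcs G \<and> f a = f b \<and> f b = f c)"

definition add_vertex :: "'a \<Rightarrow> 'a set \<Rightarrow> 'a set \<Rightarrow> 'a pair_pre_digraph \<Rightarrow> 'a pair_pre_digraph" where
  "add_vertex v I Q G = \<lparr> pverts = insert v (pverts G),
     parcs = parcs G \<union> I \<times> {v} \<union> {v} \<times> Q \<rparr>"

lemma orientedI:
  assumes "finite (pverts G)" "\<And>u v. (u, v) \<in> parcs G \<Longrightarrow> u \<in> pverts G \<and> v \<in> pverts G"
    and "\<And>u v. (u, v) \<in> parcs G \<Longrightarrow> (v, u) \<notin> parcs G"
  shows "oriented G"
proof -
  have "finite (parcs G)"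
    by (rule finite_subset[of _ "pverts G \<times> pverts G"]) (use assms in auto)
  then have "pair_digraph G"
    using assms by unfold_locales (auto, metis)
  then show ?thesis using assms(3) by (auto simp: oriented_def)
qed

lemma orientedD:
  assumes "oriented G"
  shows "finite (pverts G)" "(u, v) \<in> parcs G \<Longrightarrow> u \<in> pverts G" "(u, v) \<in> parcs G \<Longrightarrow> v \<in> pverts G"
    and "(u, v) \<in> parcs G \<Longrightarrow> (v, u) \<notin> parcs G" "(u, u) \<notin> parcs G"
proof -
  interpret pair_digraph G using assms by (simp add: oriented_def)
  show "finite (pverts G)" by (rule pair_finite_verts)
  show "(u, v) \<in> parcs G \<Longrightarrow> u \<in> pverts G" "(u, v) \<in> parcs G \<Longrightarrow> v \<in> pverts G"
    by (auto dest: in_arcsD1 in_arcsD2)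
  show "(u, v) \<in> parcs G \<Longrightarrow> (v, u) \<notin> parcs G" "(u, u) \<notin> parcs G"
    using assms by (auto simp: oriented_def)
qed

section \<open>Attaching a vertex to a transitive tournament\<close>

lemma sorted_wrt_no_triangle:
  assumes "\<And>x y. R x y \<Longrightarrow> \<not> R y x" "sorted_wrt R xs" "{a, b, c} \<subseteq> set xs"
  shows "\<not> (R a b \<and> R b c \<and> R c a)"
  using assms(2,3)
proof (induction xs)
  case (Cons x xs)
  \<comment> \<open>The triangle vertex that comes first in the list would have to be beaten by its
    predecessor on the triangle.\<close>
  have "R x y" if "y \<in> set xs" for y using Cons.prems(1) that by simp
  moreover have "y = x \<or> y \<in> set xs" if "y \<in> {a, b, c}" for y using Cons.prems(2) that by auto
  ultimately show ?case
    using Cons.IH Cons.prems(1) assms(1) by (metis insertCI insertE singletonD sorted_wrt.simps(2) subsetI)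
qed simp

lemma sorted_wrt_total:
  assumes "sorted_wrt R xs" "x \<in> set xs" "y \<in> set xs" "x \<noteq> y"
  shows "R x y \<or> R y x"
  using assms by (induction xs) auto

text \<open>The neighbours of \<open>v\<close> form the tournament \<open>ss @ xs @ ts\<close>, so
  \<open>v\<close> is simplicial. Its in-neighbours \<open>ss @ ts\<close> carry no directed
  triangle, and a triangle through \<open>v\<close> has no common out-neighbour because
  \<open>xs\<close> sits between \<open>ss\<close> and \<open>ts\<close>.\<close>

lemma good_add_vertex:
  assumes "good G" "v \<notin> pverts G" "trans_tour G (ss @ xs @ ts)"
  shows "good (add_vertex v (set ss \<union> set ts) (set xs) G)" (is "good ?H")
proof -
  have G: "oriented G" "in_triangle_free G"
    and simp: "\<And>W. W \<subseteq> pverts G \<Longrightarrow> W \<noteq> {} \<Longrightarrow> \<exists>v\<in>W. simplicial_in G W v"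
    using assms(1) by (auto simp: good_def)
  note D = orientedD[OF G(1)]
  have sub: "set ss \<subseteq> pverts G" "set xs \<subseteq> pverts G" "set ts \<subseteq> pverts G"
    and sorted: "sorted_wrt (\<lambda>x y. (x, y) \<in> parcs G) (ss @ xs @ ts)"
    using assms(3) by (auto simp: trans_tour_def)
  then have arcs: "\<And>x y. x \<in> set ss \<Longrightarrow> y \<in> set xs \<union> set ts \<Longrightarrow> (x, y) \<in> parcs G"
      "\<And>x y. x \<in> set xs \<Longrightarrow> y \<in> set ts \<Longrightarrow> (x, y) \<in> parcs G"
    and sorted': "sorted_wrt (\<lambda>x y. (x, y) \<in> parcs G) (ss @ ts)"
    by (auto simp: sorted_wrt_append)
  have v: "(v, u) \<notin> parcs G" "(u, v) \<notin> parcs G" for u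
    using assms(2) D by auto
  have disj: "set xs \<inter> (set ss \<union> set ts) = {}"
    using arcs D(5) by blast
  have H: "(x, y) \<in> parcs ?H \<longleftrightarrow>
      (x, y) \<in> parcs G \<or> (x \<in> set ss \<union> set ts \<and> y = v) \<or> (x = v \<and> y \<in> set xs)" for x y
    by (auto simp: add_vertex_def)
  have vH: "pverts ?H = insert v (pverts G)"
    by (simp add: add_vertex_def)
  have o: "oriented ?H"
  proof (rule orientedI)
    show "finite (pverts ?H)" using D(1) vH by simp
    show "\<And>x y. (x, y) \<in> parcs ?H \<Longrightarrow> x \<in> pverts ?H \<and> y \<in> pverts ?H"
      unfolding H vH using D(2,3) sub by blast
    show "\<And>x y. (x, y) \<in> parcs ?H \<Longrightarrow> (y, x) \<notin> parcs ?H"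
      unfolding H using D(4) v disj sub assms(2) by blast
  qed
  have "in_triangle_free ?H"
    unfolding in_triangle_free_def
  proof (intro notI, elim exE)
    fix a b c d
    assume "{(a, b), (b, c), (c, a), (a, d), (b, d), (c, d)} \<subseteq> parcs ?H"
    then have abc: "(a, b) \<in> parcs ?H" "(b, c) \<in> parcs ?H" "(c, a) \<in> parcs ?H"
        "(a, d) \<in> parcs ?H" "(b, d) \<in> parcs ?H" "(c, d) \<in> parcs ?H"
      by auto
    note DH = orientedD[OF o]
    \<comment> \<open>Up to rotation \<open>v\<close> is the first vertex of the triangle. Then
      \<open>q\<close> and \<open>d\<close> lie in \<open>xs\<close>; the arc from \<open>q\<close>
      to \<open>r\<close> keeps \<open>r\<close> out of \<open>ss\<close>, and the arc from
      \<open>r\<close> to \<open>d\<close> keeps it out of \<open>ts\<close>.\<close>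
    have through_v: False
      if "(v, q) \<in> parcs ?H" "(q, r) \<in> parcs ?H" "(r, v) \<in> parcs ?H"
         "(v, d) \<in> parcs ?H" "(q, d) \<in> parcs ?H" "(r, d) \<in> parcs ?H" for q r
    proof -
      have qd: "q \<in> set xs" "d \<in> set xs" using that v sub assms(2) unfolding H by blast+
      have "r \<in> set ss \<union> set ts" using that v sub assms(2) unfolding H by blast
      moreover have "(d, r) \<notin> parcs G" "(r, q) \<notin> parcs G"
        using that DH(4) H by blast+
      ultimately show False using arcs qd by blast
    qed
    show False
    proof (cases "v \<in> {a, b, c}")
      case True
      then show False using through_v abc by blast
    next
      case False
      then have G3: "(a, b) \<in> parcs G" "(b, c) \<in> parcs G" "(c, a) \<in> parcs G"
        using abc unfolding H by blast+
      show False
      proof (cases "d = v")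
        case True
        then have "{a, b, c} \<subseteq> set (ss @ ts)" using abc(4-6) v False unfolding H by auto
        from sorted_wrt_no_triangle[OF _ sorted' this] D(4) G3 show False by blast
      next
        case d: False
        then have "(a, d) \<in> parcs G" "(b, d) \<in> parcs G" "(c, d) \<in> parcs G"
          using abc False unfolding H by blast+
        with G3 G(2) show False unfolding in_triangle_free_def by blast
      qed
    qed
  qed
  \<comment> \<open>A set containing \<open>v\<close> has \<open>v\<close> as its simplicial vertex;
    on any other set the adjacency is that of \<open>G\<close>.\<close>
  moreover have "\<exists>u\<in>W. simplicial_in ?H W u" if W: "W \<subseteq> pverts ?H" "W \<noteq> {}" for W
  proof (cases "v \<in> W")
    case True
    have "adj ?H v x \<Longrightarrow> x \<in> set (ss @ xs @ ts)" for x
      using v sub assms(2) unfolding adj_def H by auto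
    then have "adj ?H x y" if "adj ?H v x" "adj ?H v y" "x \<noteq> y" for x y
      using sorted_wrt_total[OF sorted] that unfolding adj_def H by meson
    then show ?thesis using True unfolding simplicial_in_def by blast
  next
    case False
    then have "W \<subseteq> pverts G" using W vH by auto
    then obtain u where u: "u \<in> W" "simplicial_in G W u" using simp W(2) by blast
    have "adj ?H x y \<longleftrightarrow> adj G x y" if "x \<in> W" "y \<in> W" for x y
      using that False unfolding adj_def H by metis
    then show ?thesis using u unfolding simplicial_in_def by metis
  qed
  ultimately show ?thesis using o by (auto simp: good_def)
qed

section \<open>Extensions that force rainbow tournaments\<close>

lemma extends_refl: "extends G G"
  by (simp add: extends_def)

lemma extends_trans: "extends G H \<Longrightarrow> extends H K \<Longrightarrow> extends G K"
  by (auto simp: extends_def)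

lemma trans_tour_extends: "trans_tour G xs \<Longrightarrow> extends G H \<Longrightarrow> trans_tour H xs"
  by (auto simp: trans_tour_def extends_def elim!: sorted_wrt_mono_rel[rotated])

lemma no_mono_triangle_extends: "no_mono_triangle H f \<Longrightarrow> extends G H \<Longrightarrow> no_mono_triangle G f"
  unfolding no_mono_triangle_def extends_def by (meson order_trans)

text \<open>Finitely many demands are met one after another; since \<open>R\<close> persists under
  extension, later steps do not spoil earlier ones.\<close>

lemma iterate_extensions:
  assumes "finite F" "good G"
    and step: "\<And>s K. s \<in> F \<Longrightarrow> good K \<Longrightarrow> extends G K \<Longrightarrow> \<exists>H. good H \<and> extends K H \<and> R s H"
    and mono: "\<And>s K H. s \<in> F \<Longrightarrow> R s K \<Longrightarrow> extends K H \<Longrightarrow> R s H"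
  obtains H where "good H" "extends G H" "\<And>s. s \<in> F \<Longrightarrow> R s H"
proof -
  have "\<exists>H. good H \<and> extends G H \<and> (\<forall>s\<in>F. R s H)"
    using assms(1) step mono
  proof (induction F)
    case empty
    then show ?case using assms(2) extends_refl by auto
  next
    case (insert x F)
    have "\<exists>K. good K \<and> extends G K \<and> (\<forall>s\<in>F. R s K)"
      by (rule insert.IH) (rule insert.prems; simp)+
    then obtain K where K: "good K" "extends G K" "\<And>s. s \<in> F \<Longrightarrow> R s K"
      by blast
    obtain H where H: "good H" "extends K H" "R x H"
      using insert.prems(1)[OF _ K(1,2), of x] by auto
    have "R s H" if "s \<in> F" for s
      using insert.prems(2)[OF _ K(3) H(2)] that by simp
    then show ?case using H extends_trans[OF K(2) H(2)] by auto
  qed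
  then show thesis using that by blast
qed

text \<open>The \<open>itself\<close> argument fixes the type of colours, over which a formula
  cannot quantify. The prefix \<open>ss\<close> is prescribed and may repeat colours; only its
  continuation must be rainbow. Carrying a prefix lets the induction build T after S.\<close>

definition forces_rainbow :: "'c itself \<Rightarrow> nat \<Rightarrow> 'a list \<Rightarrow> 'a pair_pre_digraph \<Rightarrow> bool" where
  "forces_rainbow _ j ss G \<longleftrightarrow> (\<forall>f :: 'a \<Rightarrow> 'c. no_mono_triangle G f \<longrightarrow>
     (\<exists>ts. length ts = j \<and> trans_tour G (ss @ ts) \<and> distinct (map f ts)))"

text \<open>A colouring admissible for the larger digraph is admissible for the smaller one, and the
  tournament found there survives.\<close>

lemma forces_rainbow_extends:
  "forces_rainbow C j ss G \<Longrightarrow> extends G H \<Longrightarrow> forces_rainbow C j ss H"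
  unfolding forces_rainbow_def by (meson no_mono_triangle_extends trans_tour_extends)

text \<open>The forced tournament depends on the colouring, so the construction must serve every
  candidate; this makes the candidates finite in number.\<close>

lemma finite_trans_tours:
  assumes "good G"
  shows "finite {xs. length xs = j \<and> trans_tour G (ss @ xs)}"
proof (rule finite_subset)
  show "finite {xs. set xs \<subseteq> pverts G \<and> length xs = j}"
    using assms by (intro finite_lists_length_eq) (auto simp: good_def dest: orientedD)
qed (auto simp: trans_tour_def)

lemma rainbow_step:
  fixes f :: "'a \<Rightarrow> 'c"
  assumes S: "distinct (map f xs)" and T: "distinct (map f ts)" and len: "length ts = length xs"
    and tour: "trans_tour G (ss @ xs @ ts)" and v: "v \<in> pverts G"
    and into: "\<And>x. x \<in> set ss \<union> set ts \<Longrightarrow> (x, v) \<in> parcs G"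
    and out: "\<And>x. x \<in> set xs \<Longrightarrow> (v, x) \<in> parcs G"
    and f: "no_mono_triangle G f"
  shows "\<exists>zs. length zs = Suc (length xs) \<and> trans_tour G (ss @ zs) \<and> distinct (map f zs)"
proof (cases "f ` set ts \<subseteq> f ` set xs")
  case True
  \<comment> \<open>Both lists are rainbow and equally long, so inclusion of their colour sets is
    equality.\<close>
  have "card (f ` set ts) = card (f ` set xs)"
    using S T len by (metis distinct_card length_map set_map)
  with True have eq: "f ` set ts = f ` set xs" by (intro card_subset_eq) auto
  \<comment> \<open>A repeated colour would occur at some \<open>x\<close> in \<open>xs\<close> and
    some \<open>t\<close> in \<open>ts\<close>, making the directed triangle \<open>x\<close>,
    \<open>t\<close>, \<open>v\<close> monochromatic.\<close>
  have "f v \<notin> f ` set ts"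
  proof
    assume *: "f v \<in> f ` set ts"
    then obtain t where t: "t \<in> set ts" "f v = f t" by auto
    from * eq obtain x where x: "x \<in> set xs" "f v = f x" by auto
    have "(x, t) \<in> parcs G" using tour x t by (auto simp: trans_tour_def sorted_wrt_append)
    then have "{(x, t), (t, v), (v, x)} \<subseteq> parcs G" using x t into out by auto
    moreover have "f x = f t" "f t = f v" using x t by simp_all
    ultimately show False using f unfolding no_mono_triangle_def by blast
  qed
  then have "distinct (map f (ts @ [v]))" using T by auto
  moreover have "trans_tour G (ss @ ts @ [v])"
    using tour v into by (auto simp: trans_tour_def sorted_wrt_append)
  ultimately show ?thesis using len by (intro exI[of _ "ts @ [v]"]) auto
next
  case False
  then obtain t where t: "t \<in> set ts" "f t \<notin> f ` set xs" by auto
  then have "distinct (map f (xs @ [t]))" using S by auto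
  moreover have "trans_tour G (ss @ xs @ [t])"
    using tour t by (auto simp: trans_tour_def sorted_wrt_append)
  ultimately show ?thesis by (intro exI[of _ "xs @ [t]"]) auto
qed

lemma ex_forces_rainbow:
  fixes G :: "nat pair_pre_digraph"
  assumes "good G" "trans_tour G ss"
  shows "\<exists>H. good H \<and> extends G H \<and> forces_rainbow C j ss H"
  using assms
proof (induction j arbitrary: G ss)
  case 0
  then show ?case using extends_refl by (auto simp: forces_rainbow_def)
next
  case (Suc j)
  obtain G0 where G0: "good G0" "extends G G0" "forces_rainbow C j ss G0"
    using Suc.IH[OF Suc.prems] by blast
  \<comment> \<open>Each possible S in \<open>G0\<close> becomes part of a longer prefix
    \<open>ss @ xs\<close>, to which the induction hypothesis applies again.\<close>
  define F1 where "F1 = {xs. length xs = j \<and> trans_tour G0 (ss @ xs)}"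
  have F1: "finite F1" unfolding F1_def by (rule finite_trans_tours[OF G0(1)])
  obtain G1 where G1: "good G1" "extends G0 G1"
    "\<And>xs. xs \<in> F1 \<Longrightarrow> forces_rainbow C j (ss @ xs) G1"
  proof (rule iterate_extensions[OF F1 G0(1)])
    fix xs K assume "xs \<in> F1" "good K" "extends G0 K"
    then show "\<exists>H. good H \<and> extends K H \<and> forces_rainbow C j (ss @ xs) H"
      by (intro Suc.IH) (auto simp: F1_def intro: trans_tour_extends)
  qed (auto intro: forces_rainbow_extends)
  \<comment> \<open>The candidates for T are taken in \<open>G1\<close>, as they may use vertices
    added after \<open>G0\<close>.\<close>
  define F2 where "F2 = (SIGMA xs : F1. {ts. length ts = j \<and> trans_tour G1 ((ss @ xs) @ ts)})"
  have F2: "finite F2"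
    unfolding F2_def by (intro finite_SigmaI F1 finite_trans_tours[OF G1(1)])
  \<comment> \<open>The vertex demanded for a pair S, T is the \<open>v\<close> of
    \<open>rainbow_step\<close>. The arcs from \<open>ss\<close> let it also continue the
    prefix.\<close>
  define R where "R = (\<lambda>(xs, ts) (H :: nat pair_pre_digraph). \<exists>v\<in>pverts H. (\<forall>x\<in>set ss \<union> set ts. (x, v) \<in> parcs H) \<and>
    (\<forall>x\<in>set xs. (v, x) \<in> parcs H))"
  obtain G2 where G2: "good G2" "extends G1 G2" "\<And>p. p \<in> F2 \<Longrightarrow> R p G2"
  proof (rule iterate_extensions[OF F2 G1(1)])
    fix p :: "nat list \<times> nat list" and K
    assume p: "p \<in> F2" and K: "good K" "extends G1 K"
    obtain xs ts where [simp]: "p = (xs, ts)" by (cases p)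
    have tour: "trans_tour K (ss @ xs @ ts)"
      using p trans_tour_extends[OF _ K(2)] by (auto simp: F2_def)
    have "finite (pverts K)" using K(1) by (auto simp: good_def dest: orientedD)
    \<comment> \<open>Working over \<open>nat\<close> always leaves a fresh vertex.\<close>
    then obtain v where v: "v \<notin> pverts K" using ex_new_if_finite infinite_UNIV_nat by blast
    let ?H = "add_vertex v (set ss \<union> set ts) (set xs) K"
    have "good ?H" by (rule good_add_vertex[OF K(1) v tour])
    moreover have "extends K ?H" "R p ?H"
      by (auto simp: extends_def add_vertex_def R_def)
    ultimately show "\<exists>H. good H \<and> extends K H \<and> R p H" by blast
  next
    fix p K H
    assume "R p K" "extends K H"
    then show "R p H" by (cases p) (simp add: R_def extends_def, blast)
  qed blast
  have "forces_rainbow C (Suc j) ss G2"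
    unfolding forces_rainbow_def
  proof (intro allI impI)
    fix f :: "nat \<Rightarrow> 'a"
    assume f: "no_mono_triangle G2 f"
    \<comment> \<open>The colouring restricts to the earlier stages: \<open>G0\<close> yields
      \<open>xs\<close>, then \<open>G1\<close> yields \<open>ts\<close>, and \<open>G2\<close>
      holds the vertex prepared for this pair.\<close>
    then have f1: "no_mono_triangle G1 f" using G2(2) no_mono_triangle_extends by blast
    then have f0: "no_mono_triangle G0 f" using G1(2) no_mono_triangle_extends by blast
    obtain xs where xs: "length xs = j" "trans_tour G0 (ss @ xs)" "distinct (map f xs)"
      using G0(3) f0 unfolding forces_rainbow_def by blast
    then have "xs \<in> F1" by (simp add: F1_def)
    then obtain ts where ts: "length ts = j" "trans_tour G1 ((ss @ xs) @ ts)" "distinct (map f ts)"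
      using G1(3) f1 unfolding forces_rainbow_def by blast
    then have "(xs, ts) \<in> F2" using \<open>xs \<in> F1\<close> by (simp add: F2_def)
    then obtain v where v: "v \<in> pverts G2" "\<And>x. x \<in> set ss \<union> set ts \<Longrightarrow> (x, v) \<in> parcs G2"
      "\<And>x. x \<in> set xs \<Longrightarrow> (v, x) \<in> parcs G2"
      using G2(3) unfolding R_def by blast
    have "trans_tour G2 (ss @ xs @ ts)" using trans_tour_extends[OF ts(2) G2(2)] by simp
    from rainbow_step[OF xs(3) ts(3) _ this v f] xs(1) ts(1)
    show "\<exists>ts. length ts = Suc j \<and> trans_tour G2 (ss @ ts) \<and> distinct (map f ts)" by simp
  qed
  moreover have "extends G G2" using G0(2) G1(2) G2(2) extends_trans by blast
  ultimately show ?case using G2(1) by blast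
qed

section \<open>Induced copies and chordality\<close>

lemma contains_inducedE:
  assumes "contains_induced (with_proj G) (with_proj H)"
  obtains h where "inj_on h (pverts H)" "h ` pverts H \<subseteq> pverts G"
    "\<And>u v. u \<in> pverts H \<Longrightarrow> v \<in> pverts H \<Longrightarrow> (u, v) \<in> parcs H \<longleftrightarrow> (h u, h v) \<in> parcs G"
proof -
  obtain G' \<phi> where G': "induced_subgraph G' (with_proj G)"
    and \<phi>: "pre_digraph.digraph_isomorphism G' \<phi>" and H: "with_proj H = app_iso \<phi> G'"
    using assms unfolding contains_induced_def digraph_iso_def by blast
  have sub: "verts G' \<subseteq> pverts G"
    and arcsG': "arcs G' = {e \<in> parcs G. fst e \<in> verts G' \<and> snd e \<in> verts G'}"
    and tail: "tail G' = fst" and head: "head G' = snd"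
    using G' by (auto simp: induced_subgraph_def subgraph_def compatible_def)
  have wf: "wf_digraph G'" and inj: "inj_on (iso_verts \<phi>) (verts G')"
    using \<phi> by (auto simp: pre_digraph.digraph_isomorphism_def)
  have vH: "pverts H = iso_verts \<phi> ` verts G'"
    using arg_cong[OF H, of verts] by simp
  \<comment> \<open>An isomorphism carries a separate map on arcs, so arcs are compared through
    their end pairs.\<close>
  have "arcs_ends (with_proj H) = (\<lambda>(u, v). (iso_verts \<phi> u, iso_verts \<phi> v)) ` arcs_ends G'"
    unfolding H using wf_digraph.arcs_ends_app_iso_eq[OF wf \<phi>] .
  moreover have "arcs_ends G' = arcs G'"
    by (simp add: arcs_ends_conv tail head)
  ultimately have aH: "parcs H = (\<lambda>(u, v). (iso_verts \<phi> u, iso_verts \<phi> v)) ` arcs G'"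
    by simp
  show thesis
  \<comment> \<open>The isomorphism leads from a subdigraph of \<open>G\<close> to \<open>H\<close>;
    its inverse is the embedding sought.\<close>
  proof (rule that[of "the_inv_into (verts G') (iso_verts \<phi>)"])
    let ?h = "the_inv_into (verts G') (iso_verts \<phi>)"
    show "inj_on ?h (pverts H)" unfolding vH by (rule inj_on_the_inv_into[OF inj])
    show "?h ` pverts H \<subseteq> pverts G"
      unfolding vH using sub by (auto simp: the_inv_into_f_f[OF inj])
    fix u v assume "u \<in> pverts H" "v \<in> pverts H"
    then obtain x y where xy: "x \<in> verts G'" "y \<in> verts G'" "u = iso_verts \<phi> x" "v = iso_verts \<phi> y"
      unfolding vH by auto
    have "(u, v) \<in> parcs H \<longleftrightarrow> (x, y) \<in> arcs G'"
    proof
      assume "(u, v) \<in> parcs H"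
      then obtain x' y' where e: "(x', y') \<in> arcs G'" "u = iso_verts \<phi> x'" "v = iso_verts \<phi> y'"
        unfolding aH by auto
      then have "x' \<in> verts G'" "y' \<in> verts G'" using arcsG' by auto
      then have "x' = x" "y' = y" using e xy inj by (metis inj_onD)+
      then show "(x, y) \<in> arcs G'" using e by simp
    next
      assume "(x, y) \<in> arcs G'"
      then show "(u, v) \<in> parcs H" unfolding aH xy by (rule image_eqI[rotated]) simp
    qed
    then show "(u, v) \<in> parcs H \<longleftrightarrow> (?h u, ?h v) \<in> parcs G"
      using xy arcsG' by (simp add: the_inv_into_f_f[OF inj])
  qed
qed

lemma in_triangle_free_C3_to_K1:
  assumes "in_triangle_free G"
  shows "\<not> contains_induced (with_proj G) (with_proj C3_to_K1)"
proof
  assume "contains_induced (with_proj G) (with_proj C3_to_K1)"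
  then obtain h where h: "\<And>u v. u \<in> pverts C3_to_K1 \<Longrightarrow> v \<in> pverts C3_to_K1 \<Longrightarrow>
      (u, v) \<in> parcs C3_to_K1 \<longleftrightarrow> (h u, h v) \<in> parcs G"
    by (rule contains_inducedE) blast
  have "{(h 0, h 1), (h 1, h 2), (h 2, h 0), (h 0, h 3), (h 1, h 3), (h 2, h 3)} \<subseteq> parcs G"
    using h[of 0 1] h[of 1 2] h[of 2 0] h[of 0 3] h[of 1 3] h[of 2 3] by (simp add: C3_to_K1_def)
  then show False using assms unfolding in_triangle_free_def by (iprover intro: exI)
qed

text \<open>This says that no vertex of a cycle of length at least 4 is simplicial.\<close>

lemma cycle_graph_neighbours:
  assumes "n \<ge> 4" "i < n"
  obtains j k where "j < n" "k < n" "j \<noteq> k" "(i, j) \<in> parcs (cycle_graph n)"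
    "(i, k) \<in> parcs (cycle_graph n)" "(j, k) \<notin> parcs (cycle_graph n)"
proof -
  \<comment> \<open>Reduction modulo \<open>n\<close> wraps around only at the first and the last
    vertex.\<close>
  consider "i = 0" | "Suc i = n" | "0 < i" "Suc i < n" using assms(2) by linarith
  then show thesis
  proof cases
    case 1
    then show thesis
      using assms by (intro that[of 1 "n - 1"]) (auto simp: cycle_graph_def)
  next
    case 2
    then show thesis
      using assms by (intro that[of 0 "n - 2"]) (auto simp: cycle_graph_def)
  next
    case 3
    then show thesis
      using assms by (intro that[of "Suc i" "i - 1"]) (auto simp: cycle_graph_def mod_Suc)
  qed
qed

text \<open>The vertex set of an induced long cycle would contain a simplicial vertex, making its
  two neighbours on the cycle adjacent.\<close>

lemma chordal_mk_symmetric: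
  assumes simplicial: "\<And>W. W \<subseteq> pverts G \<Longrightarrow> W \<noteq> {} \<Longrightarrow> \<exists>v\<in>W. simplicial_in G W v"
  shows "chordal (mk_symmetric (with_proj G))"
  unfolding chordal_def
proof safe
  fix n :: nat
  assume n: "n \<ge> 4"
    and cyc: "contains_induced (with_proj (mk_symmetric (with_proj G))) (with_proj (cycle_graph n))"
  from cyc obtain h where inj: "inj_on h (pverts (cycle_graph n))"
    and sub: "h ` pverts (cycle_graph n) \<subseteq> pverts (mk_symmetric (with_proj G))"
    and arcs: "\<And>u v. u \<in> pverts (cycle_graph n) \<Longrightarrow> v \<in> pverts (cycle_graph n) \<Longrightarrow>
      (u, v) \<in> parcs (cycle_graph n) \<longleftrightarrow> (h u, h v) \<in> parcs (mk_symmetric (with_proj G))"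
    by (rule contains_inducedE) blast
  have V: "pverts (cycle_graph n) = {..<n}" by (simp add: cycle_graph_def)
  have inj: "inj_on h {..<n}" and sub: "h ` {..<n} \<subseteq> pverts G"
    using inj sub by (simp_all add: V)
  have "(x, y) \<in> parcs (mk_symmetric (with_proj G)) \<longleftrightarrow> adj G x y" for x y
    unfolding adj_def parcs_mk_symmetric by (auto intro: bexI[of _ "(y, x)"])
  then have h: "(u, v) \<in> parcs (cycle_graph n) \<longleftrightarrow> adj G (h u) (h v)" if "u < n" "v < n" for u v
    using arcs[of u v] that by (simp add: V)
  have "h 0 \<in> h ` {..<n}" using n by auto
  then have "h ` {..<n} \<noteq> {}" by blast
  then obtain i where i: "i < n" "simplicial_in G (h ` {..<n}) (h i)"
    using simplicial[OF sub] by auto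
  obtain j k where jk: "j < n" "k < n" "j \<noteq> k" "(i, j) \<in> parcs (cycle_graph n)"
    "(i, k) \<in> parcs (cycle_graph n)" "(j, k) \<notin> parcs (cycle_graph n)"
    by (rule cycle_graph_neighbours[OF n i(1)])
  then have "h j \<noteq> h k" using inj by (auto dest: inj_onD)
  then show False
    using i jk h unfolding simplicial_in_def by blast
qed

section \<open>Acyclic parts and the dichromatic number\<close>

lemma acyclic_singleton:
  assumes "oriented G"
  shows "acyclic_digraph (with_proj G \<restriction> {x})"
  unfolding acyclic_digraph_def
proof
  assume "\<exists>p. pre_digraph.cycle (with_proj G \<restriction> {x}) p"
  then obtain p where "p \<noteq> []" "set p \<subseteq> arcs (with_proj G \<restriction> {x})"
    by (auto simp: pre_digraph.cycle_def pre_digraph.awalk_def)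
  then have "hd p \<in> arcs (with_proj G \<restriction> {x})" by (meson hd_in_set subsetD)
  then have "(x, x) \<in> parcs G" by (cases "hd p") auto
  then show False using orientedD(5)[OF assms] by blast
qed

lemma acyclic_no_triangle:
  assumes "oriented G" "acyclic_digraph (with_proj G \<restriction> X)" "{a, b, c} \<subseteq> X"
  shows "\<not> {(a, b), (b, c), (c, a)} \<subseteq> parcs G"
proof
  assume *: "{(a, b), (b, c), (c, a)} \<subseteq> parcs G"
  then have "a \<noteq> b" "b \<noteq> c" "c \<noteq> a" using orientedD(5)[OF assms(1)] by auto
  then have "pre_digraph.cycle (with_proj G \<restriction> X) [(a, b), (b, c), (c, a)]"
    using * assms(3)
    by (auto simp: pre_digraph.cycle_def pre_digraph.awalk_def pre_digraph.cas.simps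
        pre_digraph.awalk_verts.simps)
  then show False using assms(2) by (auto simp: acyclic_digraph_def)
qed

text \<open>The partition into singletons is admissible, so the \<open>LEAST\<close> in the
  definition is attained.\<close>

lemma dichromatic_number_partition:
  assumes "oriented G"
  obtains P where "partition_on (pverts G) P" "finite P" "card P = dichromatic_number G"
    "\<And>X. X \<in> P \<Longrightarrow> acyclic_digraph (with_proj G \<restriction> X)"
proof -
  let ?Q = "\<lambda>k. \<exists>P. partition_on (pverts G) P \<and> finite P \<and> card P = k \<and>
     (\<forall>X\<in>P. acyclic_digraph (with_proj G \<restriction> X))"
  have "?Q (card ((\<lambda>x. {x}) ` pverts G))"
    using orientedD(1)[OF assms] acyclic_singleton[OF assms]
    by (intro exI[of _ "(\<lambda>x. {x}) ` pverts G"]) (auto intro!: partition_onI simp: disjnt_def)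
  then have "?Q (dichromatic_number G)"
    unfolding dichromatic_number_def by (rule LeastI)
  then show thesis using that by blast
qed

text \<open>The blocks of an optimal partition serve as colours, hence the colour type
  \<open>'a set\<close>; a rainbow tournament on \<open>j\<close> vertices meets \<open>j\<close>
  different blocks.\<close>

lemma dichromatic_number_ge:
  fixes G :: "'a pair_pre_digraph"
  assumes "oriented G" "forces_rainbow TYPE('a set) j [] G"
  shows "j \<le> dichromatic_number G"
proof -
  obtain P where P: "partition_on (pverts G) P" "finite P" "card P = dichromatic_number G"
    "\<And>X. X \<in> P \<Longrightarrow> acyclic_digraph (with_proj G \<restriction> X)"
    by (rule dichromatic_number_partition[OF assms(1)]) blast
  have "\<exists>X. X \<in> P \<and> x \<in> X" if "x \<in> pverts G" for x
    using P(1) that by (auto simp: partition_on_def)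
  then obtain f where f: "\<And>x. x \<in> pverts G \<Longrightarrow> f x \<in> P \<and> x \<in> f x" by metis
  have "no_mono_triangle G f"
    unfolding no_mono_triangle_def
  proof (intro notI, elim exE conjE)
    fix a b c
    assume abc: "{(a, b), (b, c), (c, a)} \<subseteq> parcs G" "f a = f b" "f b = f c"
    then have "a \<in> pverts G" "b \<in> pverts G" "c \<in> pverts G"
      using orientedD(2)[OF assms(1)] by auto
    then have "f a \<in> P" "{a, b, c} \<subseteq> f a" using f abc(2,3) by auto
    then show False using acyclic_no_triangle[OF assms(1) P(4)] abc(1) by blast
  qed
  then obtain ts where ts: "length ts = j" "trans_tour G ts" "distinct (map f ts)"
    using assms(2) unfolding forces_rainbow_def by force
  have "j = card (f ` set ts)" using ts by (metis distinct_card length_map set_map)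
  also have "\<dots> \<le> card P"
    using ts(2) f P(2) by (intro card_mono) (auto simp: trans_tour_def)
  finally show ?thesis using P(3) by simp
qed

section \<open>Unbounded dichromatic number\<close>

lemma good_empty: "good \<lparr>pverts = {}, parcs = {}\<rparr>"
proof -
  have "oriented \<lparr>pverts = {}, parcs = {}\<rparr>" by (rule orientedI) simp_all
  then show ?thesis by (simp add: good_def in_triangle_free_def)
qed

lemma ex_chordal_orientation_large_dichromatic:
  "\<exists>G :: nat pair_pre_digraph. G \<in> chordal_orientations \<and>
     \<not> contains_induced (with_proj G) (with_proj C3_to_K1) \<and> j \<le> dichromatic_number G"
proof -
  \<comment> \<open>The construction starts from the empty digraph with the empty prefix.\<close>
  have "trans_tour \<lparr>pverts = {}, parcs = {}\<rparr> []" by (simp add: trans_tour_def)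
  from ex_forces_rainbow[OF good_empty this]
  obtain G :: "nat pair_pre_digraph" where G: "good G" "forces_rainbow TYPE(nat set) j [] G"
    by blast
  then have "G \<in> chordal_orientations"
    by (auto simp: chordal_orientations_def good_def intro!: chordal_mk_symmetric)
  then show ?thesis
    using G dichromatic_number_ge in_triangle_free_C3_to_K1 by (auto simp: good_def)
qed

theorem theorem2p10:
  shows "\<not> hero_in C3_to_K1 (chordal_orientations :: nat pair_pre_digraph set) \<and>
    (\<forall>k :: int. \<exists>G :: nat pair_pre_digraph. G \<in> chordal_orientations \<and>
       \<not> contains_induced (with_proj G) (with_proj C3_to_K1) \<and>
       int (dichromatic_number G) > k)"
proof (intro conjI allI notI)
  assume "hero_in C3_to_K1 (chordal_orientations :: nat pair_pre_digraph set)"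
  then obtain k where "\<forall>G\<in>chordal_orientations :: nat pair_pre_digraph set.
      \<not> contains_induced (with_proj G) (with_proj C3_to_K1) \<longrightarrow> dichromatic_number G \<le> k"
    unfolding hero_in_def by blast
  then show False using ex_chordal_orientation_large_dichromatic[of "Suc k"] by fastforce
next
  fix k :: int
  \<comment> \<open>A negative \<open>k\<close> is truncated to 0 by \<open>nat\<close>; in every
    case \<open>Suc (nat k)\<close> exceeds \<open>k\<close>.\<close>
  obtain G :: "nat pair_pre_digraph" where "G \<in> chordal_orientations"
    "\<not> contains_induced (with_proj G) (with_proj C3_to_K1)" "Suc (nat k) \<le> dichromatic_number G"
    using ex_chordal_orientation_large_dichromatic by blast
  then show "\<exists>G :: nat pair_pre_digraph. G \<in> chordal_orientations \<and>
       \<not> contains_induced (with_proj G) (with_proj C3_to_K1) \<and> int (dichromatic_number G) > k"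
    by (intro exI[of _ G]) auto
qed

end
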